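(* There is a constant $C$ depending only on $f$ and $b$ such that the following holds. Let $N\in\mathbb{N}$, let $a_0,\dots,a_N,b_1,\dots,b_N$ be complex numbers, let $$K_{f,N}(x,t)=a_{0}u_{0}(x,t)+\sum_{n=1}^{N}a_{n}u_{2n-1}(x,t)+\sum_{n=1}^{N}b_{n}u_{2n}(x,t),$$ and suppose $\max_{\overline{\mathbf{S}}}|\mathbf{K}_{f}-K_{f,N}|<\varepsilon$. Put $b_0=h/2$ and $$K_{1/f,N}(x,t)=-\Bigl(b_{0}v_{0}(x,t)+\sum_{n=1}^{N}\bigl(a_{n}v_{2n}(x,t)+b_{n}v_{2n-1}(x,t)\bigr)\Bigr).$$ Then $\max_{\overline{\mathbf{S}}}|\mathbf{K}_{1/f}-K_{1/f,N}|<\varepsilon C$.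
   Context: Setting. Let $b>0$, let $q:[-b,b]\to\mathbb{C}$ be continuous, and let $f\in C^{2}[-b,b]$ be a complex-valued solution of $f''-qf=0$ with $f(x)\neq 0$ on $[-b,b]$ and $f(0)=1$. Put $h:=f'(0)\in\mathbb{C}$. Let $\overline{\mathbf{S}}=[-b,b]\times[-b,b]$ in the $(x,t)$-plane. Recursive integrals: $X^{(0)}\equiv \widetilde X^{(0)}\equiv 1$ and, for $n\ge 1$, $X^{(n)}(x)=n\int_{0}^{x}X^{(n-1)}(s)(f^{2}(s))^{(-1)^{n}}ds$, $\widetilde X^{(n)}(x)=n\int_{0}^{x}\widetilde X^{(n-1)}(s)(f^{2}(s))^{(-1)^{n-1}}ds$. Put $\varphi_k=fX^{(k)}$, $\psi_k=\widetilde X^{(k)}/f$ for $k$ odd, and $\varphi_k=f\widetilde X^{(k)}$, $\psi_k=X^{(k)}/f$ for $k$ even. Generalized wave polynomials: $u_0(x,t)=\varphi_0(x)$, $v_0(x,t)=\psi_0(x)$ and, for $n\ge1$, $$u_{2n-1}(x,t)=\sum_{\substack{0\le k\le n\\k\text{ even}}}\binom nk\varphi_{n-k}(x)t^k,\qquad u_{2n}(x,t)=\sum_{\substack{1\le k\le n\\k\text{ odd}}}\binom nk\varphi_{n-k}(x)t^k,$$ $$v_{2n-1}(x,t)=\sum_{\substack{0\le k\le n\\k\text{ even}}}\binom nk\psi_{n-k}(x)t^k,\qquad v_{2n}(x,t)=\sum_{\substack{1\le k\le n\\k\text{ odd}}}\binom nk\psi_{n-k}(x)t^k.$$ Kernels: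 $\mathbf{K}_{f}(x,t)=\mathbf{H}\bigl(\tfrac{x+t}{2},\tfrac{x-t}{2}\bigr)$ for $(x,t)\in\overline{\mathbf{S}}$, where $\mathbf{H}$ is the unique solution of the Goursat problem $$\frac{\partial^{2}\mathbf{H}(u,v)}{\partial u\,\partial v}=q(u+v)\mathbf{H}(u,v),\qquad \mathbf{H}(u,0)=\frac h2+\frac12\int_0^u q(s)\,ds,\qquad \mathbf{H}(0,v)=\frac h2.$$ $\mathbf{K}_{1/f}$ is the kernel obtained by the same construction from the function $1/f$, which solves $g''-q_Dg=0$ with the Darboux associated potential $q_D=-q+2(f'/f)^2$ and satisfies $(1/f)(0)=1$, $(1/f)'(0)=-h$; that is, in the Goursat problem $q$ is replaced by $q_D$ and $h$ by $-h$. *)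

theory Defs
  imports "HOL-Analysis.Analysis"
begin

text \<open>
  The interval integrals \<open>LBINT s=0..x. g s\<close> are oriented, so the recursive integrals below are
  meaningful for negative \<open>x\<close> as well.
\<close>

primrec rec_X :: "(real \<Rightarrow> complex) \<Rightarrow> nat \<Rightarrow> real \<Rightarrow> complex" where
  "rec_X f 0 = (\<lambda>x. 1)"
| "rec_X f (Suc n) =
    (\<lambda>x. of_nat (Suc n) *
      (LBINT s=ereal 0..ereal x. rec_X f n s * ((f s)\<^sup>2) powi ((-1) ^ Suc n)))"

primrec rec_Xt :: "(real \<Rightarrow> complex) \<Rightarrow> nat \<Rightarrow> real \<Rightarrow> complex" where
  "rec_Xt f 0 = (\<lambda>x. 1)"
| "rec_Xt f (Suc n) =
    (\<lambda>x. of_nat (Suc n) *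
      (LBINT s=ereal 0..ereal x. rec_Xt f n s * ((f s)\<^sup>2) powi ((-1) ^ n)))"

definition phi :: "(real \<Rightarrow> complex) \<Rightarrow> nat \<Rightarrow> real \<Rightarrow> complex" where
  "phi f k x = (if odd k then f x * rec_X f k x else f x * rec_Xt f k x)"

definition psi :: "(real \<Rightarrow> complex) \<Rightarrow> nat \<Rightarrow> real \<Rightarrow> complex" where
  "psi f k x = (if odd k then rec_Xt f k x / f x else rec_X f k x / f x)"

text \<open>
  The family built from a sequence \<open>p\<close> of functions of \<open>x\<close>; \<open>m = 2 * n - 1\<close> and \<open>m = 2 * n\<close>
  (with \<open>n \<ge> 1\<close>) carry the even and the odd powers of \<open>t\<close>, respectively.
\<close>

definition wave_poly :: "(nat \<Rightarrow> real \<Rightarrow> complex) \<Rightarrow> nat \<Rightarrow> real \<Rightarrow> real \<Rightarrow> complex" where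
  "wave_poly p m x t =
    (if m = 0 then p 0 x
     else if odd m then
       (let n = (m + 1) div 2 in
         \<Sum>k\<in>{k. 0 \<le> k \<and> k \<le> n \<and> even k}. of_nat (n choose k) * p (n - k) x * of_real t ^ k)
     else
       (let n = m div 2 in
         \<Sum>k\<in>{k. 1 \<le> k \<and> k \<le> n \<and> odd k}. of_nat (n choose k) * p (n - k) x * of_real t ^ k))"

definition wave_u :: "(real \<Rightarrow> complex) \<Rightarrow> nat \<Rightarrow> real \<Rightarrow> real \<Rightarrow> complex" where
  "wave_u f = wave_poly (phi f)"

definition wave_v :: "(real \<Rightarrow> complex) \<Rightarrow> nat \<Rightarrow> real \<Rightarrow> real \<Rightarrow> complex" where
  "wave_v f = wave_poly (psi f)"

text \<open>
  In the characteristic coordinates \<open>u = (x + t) / 2\<close>, \<open>v = (x - t) / 2\<close> the square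
  \<open>\<bar>x\<bar> \<le> b\<close>, \<open>\<bar>t\<bar> \<le> b\<close> becomes the diamond \<open>\<bar>u\<bar> + \<bar>v\<bar> \<le> b\<close>. The equation is imposed in the
  open diamond (at a corner of the closed one a one-sided partial derivative can be meaningless),
  with \<open>H\<close> continuous on the closed diamond; together with the data on the two characteristics
  this determines \<open>H\<close> on the closed diamond. \<open>Hv\<close> is the partial derivative of \<open>H\<close> in \<open>v\<close>.
\<close>

definition goursat_solution ::
    "real \<Rightarrow> (real \<Rightarrow> complex) \<Rightarrow> complex \<Rightarrow> (real \<Rightarrow> real \<Rightarrow> complex) \<Rightarrow> bool" where
  "goursat_solution b q h H \<longleftrightarrow>
    continuous_on {(u, v). \<bar>u\<bar> + \<bar>v\<bar> \<le> b} (\<lambda>(u, v). H u v) \<and>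
    (\<exists>Hv. \<forall>u v. \<bar>u\<bar> + \<bar>v\<bar> < b \<longrightarrow>
       ((\<lambda>y. H u y) has_vector_derivative Hv u v) (at v) \<and>
       ((\<lambda>y. Hv y v) has_vector_derivative q (u + v) * H u v) (at u)) \<and>
    (\<forall>u\<in>{-b..b}. H u 0 = h / 2 + (1 / 2) * (LBINT s=ereal 0..ereal u. q s)) \<and>
    (\<forall>v\<in>{-b..b}. H 0 v = h / 2)"

definition kernel_of :: "(real \<Rightarrow> real \<Rightarrow> complex) \<Rightarrow> real \<Rightarrow> real \<Rightarrow> complex" where
  "kernel_of H x t = H ((x + t) / 2) ((x - t) / 2)"

text \<open>Here \<open>f'\<close> is the derivative of \<open>f\<close>.\<close>

definition darboux_potential ::
    "(real \<Rightarrow> complex) \<Rightarrow> (real \<Rightarrow> complex) \<Rightarrow> (real \<Rightarrow> complex) \<Rightarrow> real \<Rightarrow> complex" where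
  "darboux_potential q f f' x = - q x + 2 * (f' x / f x)\<^sup>2"

definition approx_K ::
    "(real \<Rightarrow> complex) \<Rightarrow> nat \<Rightarrow> (nat \<Rightarrow> complex) \<Rightarrow> (nat \<Rightarrow> complex) \<Rightarrow> real \<Rightarrow> real \<Rightarrow> complex" where
  "approx_K f N \<alpha> \<beta> x t =
    \<alpha> 0 * wave_u f 0 x t
    + (\<Sum>n = 1..N. \<alpha> n * wave_u f (2 * n - 1) x t)
    + (\<Sum>n = 1..N. \<beta> n * wave_u f (2 * n) x t)"

definition approx_K_darboux ::
    "(real \<Rightarrow> complex) \<Rightarrow> nat \<Rightarrow> (nat \<Rightarrow> complex) \<Rightarrow> (nat \<Rightarrow> complex) \<Rightarrow> real \<Rightarrow> real \<Rightarrow> complex" where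
  "approx_K_darboux f N \<alpha> \<beta> x t =
    - (\<beta> 0 * wave_v f 0 x t
       + (\<Sum>n = 1..N. \<alpha> n * wave_v f (2 * n) x t + \<beta> n * wave_v f (2 * n - 1) x t))"

end

theory Submission
  imports Defs
begin

text \<open>
  Put \<open>u = (x + t) / 2\<close>, \<open>v = (x - t) / 2\<close>, \<open>g = f' / f\<close>, and let \<open>W\<close>, \<open>Z\<close> be the two kernels, the two
  approximants, or the two errors. In all three cases \<open>(Z + W)\<^sub>u + g (Z - W) = 0\<close> and
  \<open>(Z - W)\<^sub>v + g (Z + W) = 0\<close>, that is, \<open>(f (Z + W))\<^sub>u = 2 f' W\<close> and \<open>(f (Z - W))\<^sub>v = - 2 f' W\<close>. For the errors,
  \<open>Z\<close> vanishes at the origin because of \<open>b\<^sub>0 = h / 2\<close>, so the mean value inequality along the path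
  \<open>(0, 0) \<rightarrow> (0, v) \<rightarrow> (u, v)\<close> bounds \<open>Z\<close> by a multiple of the maximum of \<open>\<bar>W\<bar>\<close>.
\<close>

text \<open>The factor \<open>f\<close> is an integrating factor: since \<open>f' = g f\<close>,
  multiplying by it removes Z from both right-hand sides. Two integrations then bound Z outright,
  without a Gronwall argument, and the constant involves only \<open>b\<close> and bounds of
  \<open>f\<close>, \<open>f'\<close> and \<open>1 / f\<close>. The approximants satisfy the
  first-order system exactly, term by term, whatever the coefficients are. The kernels are the hard
  case: each is known only through its own second-order Goursat problem, posed in the open diamond
  and naming only the derivative in v. The system is obtained for them by showing that its two
  defects have zero characteristic data and solve a linear system whose only bounded solution is
  zero. The path is chosen with this in mind: on u = 0 both kernels are constant, so the second
  equation is immediate there up to the boundary; the second leg has its interior in the open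
  diamond, and its endpoints are reached by continuity.\<close>

text \<open>Orientation-free, since all coordinates may be negative. Derivatives are asked for on
  the open segment only, because a path may end on the boundary of the diamond.\<close>

lemma norm_diff_le_closed_segment:
  fixes \<phi> :: "real \<Rightarrow> complex"
  assumes cont: "continuous_on (closed_segment a x) \<phi>"
    and der: "\<And>s. s \<in> open_segment a x \<Longrightarrow> (\<phi> has_vector_derivative \<phi>' s) (at s)"
    and bd: "\<And>s. s \<in> open_segment a x \<Longrightarrow> cmod (\<phi>' s) \<le> B"
  shows "cmod (\<phi> x - \<phi> a) \<le> B * \<bar>x - a\<bar>"
proof -
  have *: "cmod (\<phi> y - \<phi> c) \<le> B * (y - c)"
    if "c < y" "closed_segment a x = {c..y}" "open_segment a x = {c<..<y}" for c y
  proof -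
    have "cmod (\<phi> y - \<phi> c) \<le> B * y - B * c"
    proof (rule differentiable_bound_general[where f' = \<phi>' and \<phi>' = "\<lambda>_. B"])
      show "continuous_on {c..y} \<phi>" using cont that by simp
      show "((*) B has_vector_derivative B) (at s)" for s
        by (auto intro!: derivative_eq_intros)
    qed (use that der bd in \<open>auto intro!: continuous_intros\<close>)
    then show ?thesis by (simp add: algebra_simps)
  qed
  consider "a < x" | "x < a" | "a = x" by linarith
  then show ?thesis
  proof cases
    case 1
    then show ?thesis
      using *[of a x] by (simp add: closed_segment_eq_real_ivl open_segment_eq_real_ivl)
  next
    case 2
    then show ?thesis
      using *[of x a] by (simp add: closed_segment_eq_real_ivl open_segment_eq_real_ivl norm_minus_commute)
  qed auto
qed

section \<open>Umbral form of the generalized wave polynomials\<close>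

text \<open>The umbral power \<open>(p + t)\<^sup>n\<close>; its parts even and odd in \<open>t\<close> are the two families in \<open>wave_poly\<close>.\<close>

definition umbral_poly :: "(nat \<Rightarrow> real \<Rightarrow> complex) \<Rightarrow> nat \<Rightarrow> real \<Rightarrow> real \<Rightarrow> complex" where
  "umbral_poly p n x t = (\<Sum>k\<le>n. of_nat (n choose k) * p (n - k) x * of_real t ^ k)"

lemma umbral_poly_0 [simp]: "umbral_poly p 0 x t = p 0 x"
  by (simp add: umbral_poly_def)

lemma umbral_poly_even_part:
  "(\<Sum>k\<in>{k. 0 \<le> k \<and> k \<le> n \<and> even k}. of_nat (n choose k) * p (n - k) x * of_real t ^ k)
    = (umbral_poly p n x t + umbral_poly p n x (- t)) / 2" (is "sum ?g _ = _")
proof -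
  have "{k. 0 \<le> k \<and> k \<le> n \<and> even k} = {k\<in>{..n}. even k}" by auto
  then have "sum ?g {k. 0 \<le> k \<and> k \<le> n \<and> even k} = (\<Sum>k\<le>n. if even k then ?g k else 0)"
    by (simp only: sum.inter_filter[OF finite_atMost])
  also have "\<dots> = (umbral_poly p n x t + umbral_poly p n x (- t)) / 2"
    unfolding umbral_poly_def sum.distrib[symmetric] sum_divide_distrib
    by (rule sum.cong[OF refl]) (simp add: uminus_power_if)
  finally show ?thesis .
qed

lemma umbral_poly_odd_part:
  "(\<Sum>k\<in>{k. 1 \<le> k \<and> k \<le> n \<and> odd k}. of_nat (n choose k) * p (n - k) x * of_real t ^ k)
    = (umbral_poly p n x t - umbral_poly p n x (- t)) / 2" (is "sum ?g _ = _")
proof -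
  have "{k. 1 \<le> k \<and> k \<le> n \<and> odd k} = {k\<in>{..n}. odd k}" by (auto elim: oddE)
  then have "sum ?g {k. 1 \<le> k \<and> k \<le> n \<and> odd k} = (\<Sum>k\<le>n. if odd k then ?g k else 0)"
    by (simp only: sum.inter_filter[OF finite_atMost])
  also have "\<dots> = (umbral_poly p n x t - umbral_poly p n x (- t)) / 2"
    unfolding umbral_poly_def sum_subtractf[symmetric] sum_divide_distrib
    by (rule sum.cong[OF refl]) (simp add: uminus_power_if)
  finally show ?thesis .
qed

lemma wave_poly_odd:
  "n > 0 \<Longrightarrow> wave_poly p (2 * n - 1) x t = (umbral_poly p n x t + umbral_poly p n x (- t)) / 2"
  unfolding wave_poly_def umbral_poly_even_part[symmetric] by (auto simp: Let_def)

lemma wave_poly_even: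
  "n > 0 \<Longrightarrow> wave_poly p (2 * n) x t = (umbral_poly p n x t - umbral_poly p n x (- t)) / 2"
  unfolding wave_poly_def umbral_poly_odd_part[symmetric] by (auto simp: Let_def)

text \<open>The even and odd families become one family evaluated at \<open>t\<close> and
  \<open>- t\<close>. The term n = 0 fits in because \<open>\<beta> 0\<close> cancels there, so the
  coefficients can be shared with the Darboux approximant.\<close>

lemma approx_K_umbral:
  "approx_K f N \<alpha> \<beta> x t = (\<Sum>n\<le>N. (\<alpha> n + \<beta> n) / 2 * umbral_poly (phi f) n x t
      + (\<alpha> n - \<beta> n) / 2 * umbral_poly (phi f) n x (- t))" (is "_ = sum ?h _")
proof -
  have terms: "(\<Sum>n = 1..N. \<alpha> n * wave_u f (2 * n - 1) x t + \<beta> n * wave_u f (2 * n) x t) = sum ?h {1..N}"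
  proof (rule sum.cong[OF refl])
    fix n assume "n \<in> {1..N}"
    then have "n > 0" by simp
    then show "\<alpha> n * wave_u f (2 * n - 1) x t + \<beta> n * wave_u f (2 * n) x t = ?h n"
      unfolding wave_u_def wave_poly_odd[OF \<open>n > 0\<close>] wave_poly_even[OF \<open>n > 0\<close>]
      by (simp add: field_simps)
  qed
  have "\<alpha> 0 * wave_u f 0 x t = ?h 0"
    by (simp add: wave_u_def wave_poly_def field_simps)
  moreover have "sum ?h {..N} = ?h 0 + sum ?h {1..N}"
    by (simp add: sum.atMost_shift sum.atLeast1_atMost_eq lessThan_Suc_atMost)
  ultimately show ?thesis
    unfolding approx_K_def add.assoc sum.distrib[symmetric] terms by (simp only: add.assoc)
qed

text \<open>The exchange of the even and odd families shows up only as a sign on the reflected term.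
  At n = 0 it is now \<open>\<alpha> 0\<close> that cancels, leaving
  \<open>\<beta> 0\<close>.\<close>

lemma approx_K_darboux_umbral:
  "approx_K_darboux f N \<alpha> \<beta> x t = - (\<Sum>n\<le>N. (\<alpha> n + \<beta> n) / 2 * umbral_poly (psi f) n x t
      - (\<alpha> n - \<beta> n) / 2 * umbral_poly (psi f) n x (- t))" (is "_ = - sum ?h _")
proof -
  have terms: "(\<Sum>n = 1..N. \<alpha> n * wave_v f (2 * n) x t + \<beta> n * wave_v f (2 * n - 1) x t) = sum ?h {1..N}"
  proof (rule sum.cong[OF refl])
    fix n assume "n \<in> {1..N}"
    then have "n > 0" by simp
    then show "\<alpha> n * wave_v f (2 * n) x t + \<beta> n * wave_v f (2 * n - 1) x t = ?h n"
      unfolding wave_v_def wave_poly_odd[OF \<open>n > 0\<close>] wave_poly_even[OF \<open>n > 0\<close>]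
      by (simp add: field_simps)
  qed
  have "\<beta> 0 * wave_v f 0 x t = ?h 0"
    by (simp add: wave_v_def wave_poly_def field_simps)
  moreover have "sum ?h {..N} = ?h 0 + sum ?h {1..N}"
    by (simp add: sum.atMost_shift sum.atLeast1_atMost_eq lessThan_Suc_atMost)
  ultimately show ?thesis
    unfolding approx_K_darboux_def terms by (simp only:)
qed

text \<open>Umbral power rule in x: what remains of the x-derivative when the k-th function
  differentiates to k times its predecessor. It rests on the absorption identity (n choose k) (n -
  k) = n (n - 1 choose k).\<close>

lemma umbral_poly_lower_x:
  "(\<Sum>k\<le>n. of_nat (n choose k) * (of_nat (n - k) * p (n - k - 1) x) * of_real t ^ k)
    = of_nat n * umbral_poly p (n - 1) x t"
proof (cases n)
  case (Suc m)
  have *: "(of_nat (Suc m choose k) * of_nat (Suc m - k) :: complex) = of_nat (Suc m) * of_nat (m choose k)" for k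
    unfolding of_nat_mult[symmetric]
    using binomial_absorb_comp[of "Suc m" k] by (simp only: diff_Suc_1 mult.commute)
  have "(\<Sum>k\<le>Suc m. of_nat (Suc m choose k) * (of_nat (Suc m - k) * p (Suc m - k - 1) x) * of_real t ^ k)
      = (\<Sum>k\<le>m. of_nat (Suc m choose k) * (of_nat (Suc m - k) * p (Suc m - k - 1) x) * of_real t ^ k)"
    by simp
  also have "\<dots> = (\<Sum>k\<le>m. of_nat (Suc m) * (of_nat (m choose k) * p (m - k) x * of_real t ^ k))"
    by (rule sum.cong) (simp_all only: mult.assoc[symmetric] *, simp add: Suc_diff_le)
  finally show ?thesis
    unfolding umbral_poly_def Suc sum_distrib_left by simp
qed auto

text \<open>Umbral power rule in t; here absorption is combined with the index shift k to k +
  1.\<close>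

lemma umbral_poly_lower_t:
  "(\<Sum>k\<le>n. of_nat (n choose k) * p (n - k) x * (of_nat k * of_real t ^ (k - 1)))
    = of_nat n * umbral_poly p (n - 1) x t"
proof (cases n)
  case (Suc m)
  have *: "(of_nat (Suc m choose Suc k) * P * (of_nat (Suc k) * T) :: complex)
      = of_nat (Suc m) * (of_nat (m choose k) * P * T)" for k P T
  proof -
    have "(of_nat (Suc m choose Suc k) * of_nat (Suc k) :: complex) = of_nat (Suc m) * of_nat (m choose k)"
      unfolding of_nat_mult[symmetric] using Suc_times_binomial[of k m] by (simp only: mult.commute)
    then show ?thesis by (metis mult.assoc mult.commute)
  qed
  show ?thesis
    unfolding umbral_poly_def Suc sum_distrib_left sum.atMost_Suc_shift diff_Suc_1 diff_Suc_Suc *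
    by (simp only: of_nat_0 mult_zero_left mult_zero_right add_0)
qed auto

text \<open>Derivative along a curve t = T(x). The first sum is left unevaluated because
  \<open>phi\<close> and \<open>f * psi\<close> obey different differentiation rules.\<close>

lemma umbral_poly_deriv:
  assumes p: "\<And>k. (p k has_vector_derivative p' k) (at x within S)"
    and T: "(T has_vector_derivative T') (at x within S)"
  shows "((\<lambda>s. umbral_poly p n s (T s)) has_vector_derivative
    (\<Sum>k\<le>n. of_nat (n choose k) * p' (n - k) * of_real (T x) ^ k)
      + of_real T' * (of_nat n * umbral_poly p (n - 1) x (T x))) (at x within S)"
proof -
  have "((\<lambda>s. complex_of_real (T s ^ k)) has_vector_derivative of_real (of_nat k * T' * T x ^ (k - 1)))
    (at x within S)" for k
    by (rule has_vector_derivative_of_real)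
      (use T in \<open>auto intro!: derivative_eq_intros simp: has_real_derivative_iff_has_vector_derivative[symmetric]\<close>)
  then have *: "((\<lambda>s. complex_of_real (T s) ^ k) has_vector_derivative
      of_real T' * (of_nat k * of_real (T x) ^ (k - 1))) (at x within S)" for k
    by (simp add: mult_ac)
  have "((\<lambda>s. umbral_poly p n s (T s)) has_vector_derivative
      (\<Sum>k\<le>n. of_nat (n choose k) * p (n - k) x * (of_real T' * (of_nat k * of_real (T x) ^ (k - 1)))
        + of_nat (n choose k) * p' (n - k) * of_real (T x) ^ k)) (at x within S)"
    unfolding umbral_poly_def
    by (intro has_vector_derivative_sum has_vector_derivative_mult has_vector_derivative_mult_right p *)
  then show ?thesis
    unfolding umbral_poly_lower_t[symmetric] sum.distrib sum_distrib_left
    by (simp add: mult_ac add.commute)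
qed

section \<open>First derivatives of Goursat solutions\<close>

lemma compact_diamond: "compact {(u, v). \<bar>u\<bar> + \<bar>v\<bar> \<le> (b::real)}"
proof -
  have "closed {z. \<bar>fst z\<bar> + \<bar>snd z\<bar> \<le> b}"
    by (intro closed_Collect_le continuous_intros)
  moreover have "{z. \<bar>fst z\<bar> + \<bar>snd z\<bar> \<le> b} \<subseteq> cbox (-b, -b) (b, b)"
    by (auto simp: cbox_Pair_eq)
  ultimately have "compact {z. \<bar>fst z\<bar> + \<bar>snd z\<bar> \<le> b}"
    by (meson bounded_cbox bounded_subset compact_eq_bounded_closed)
  moreover have "{z. \<bar>fst z\<bar> + \<bar>snd z\<bar> \<le> b} = {(u, v). \<bar>u\<bar> + \<bar>v\<bar> \<le> b}" by auto
  ultimately show ?thesis by simp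
qed

lemma continuous_on_compact_norm_bound:
  fixes F :: "'a::topological_space \<Rightarrow> complex"
  assumes "compact S" "continuous_on S F"
  obtains M where "M \<ge> 0" "\<And>x. x \<in> S \<Longrightarrow> cmod (F x) \<le> M"
proof -
  have "bounded (F ` S)"
    using assms compact_continuous_image compact_imp_bounded by blast
  then obtain M where "\<And>x. x \<in> S \<Longrightarrow> cmod (F x) \<le> M"
    by (auto simp: bounded_iff)
  then show ?thesis
    by (intro that[of "max M 0"]) (auto simp: le_max_iff_disj)
qed

text \<open>Restores the symmetry between u and v: \<open>goursat_solution\<close> supplies the
  derivative in v and then the mixed one, while the derivative in u must be shown to exist. The
  common bound \<open>M\<close> is what the uniqueness argument for the defects starts from.\<close>

lemma goursat_solution_derivs:
  assumes sol: "goursat_solution b q h H" and q: "continuous_on {-b..b} q"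
  obtains Hu Hv M where
    "\<And>u v. \<bar>u\<bar> + \<bar>v\<bar> < b \<Longrightarrow> ((\<lambda>y. H y v) has_vector_derivative Hu u v) (at u)"
    "\<And>u v. \<bar>u\<bar> + \<bar>v\<bar> < b \<Longrightarrow> (H u has_vector_derivative Hv u v) (at v)"
    "\<And>u v. \<bar>u\<bar> + \<bar>v\<bar> < b \<Longrightarrow> (Hu u has_vector_derivative q (u + v) * H u v) (at v)"
    "\<And>u v. \<bar>u\<bar> + \<bar>v\<bar> < b \<Longrightarrow> ((\<lambda>y. Hv y v) has_vector_derivative q (u + v) * H u v) (at u)"
    "\<And>u. Hu u 0 = q u / 2"
    "\<And>v. \<bar>v\<bar> < b \<Longrightarrow> Hv 0 v = 0"
    "\<And>u v. \<bar>u\<bar> + \<bar>v\<bar> < b \<Longrightarrow> cmod (Hu u v) \<le> M"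
    "\<And>u v. \<bar>u\<bar> + \<bar>v\<bar> < b \<Longrightarrow> cmod (Hv u v) \<le> M"
    "\<And>u v. \<bar>u\<bar> + \<bar>v\<bar> < b \<Longrightarrow> cmod (H u v) \<le> M"
proof -
  let ?D = "{(u, v). \<bar>u\<bar> + \<bar>v\<bar> \<le> b}"
  define k where "k u v = q (u + v) * H u v" for u v
  from sol have H_cont: "continuous_on ?D (\<lambda>(u, v). H u v)"
    and H_u0: "\<And>u. u \<in> {-b..b} \<Longrightarrow> H u 0 = h / 2 + (1 / 2) * (LBINT s=ereal 0..ereal u. q s)"
    and H_0v: "\<And>v. v \<in> {-b..b} \<Longrightarrow> H 0 v = h / 2"
    by (auto simp: goursat_solution_def)
  from sol obtain Hv
    where Hv: "\<And>u v. \<bar>u\<bar> + \<bar>v\<bar> < b \<Longrightarrow> (H u has_vector_derivative Hv u v) (at v)"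
      and Hvu: "\<And>u v. \<bar>u\<bar> + \<bar>v\<bar> < b \<Longrightarrow> ((\<lambda>y. Hv y v) has_vector_derivative k u v) (at u)"
    unfolding goursat_solution_def k_def by blast
  have "continuous_on ?D (\<lambda>z. q (fst z + snd z))"
    by (rule continuous_on_compose2[OF q]) (auto intro!: continuous_intros)
  then have k_cont: "continuous_on ?D (\<lambda>(u, v). k u v)"
    using continuous_on_mult[OF _ H_cont] by (auto simp: k_def case_prod_beta)
  obtain B where "B \<ge> 0" and B: "\<And>u v. \<bar>u\<bar> + \<bar>v\<bar> \<le> b \<Longrightarrow> cmod (k u v) \<le> B"
    using continuous_on_compact_norm_bound[OF compact_diamond k_cont] by auto
  obtain BH where BH: "\<And>u v. \<bar>u\<bar> + \<bar>v\<bar> \<le> b \<Longrightarrow> cmod (H u v) \<le> BH"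
    by (rule continuous_on_compact_norm_bound[OF compact_diamond H_cont]) auto
  obtain Bq where "Bq \<ge> 0" and Bq: "\<And>x. x \<in> {-b..b} \<Longrightarrow> cmod (q x) \<le> Bq"
    using continuous_on_compact_norm_bound[OF compact_Icc q] by auto
  \<comment> \<open>The candidate for the u-derivative: the mixed derivative is integrated in v,
    starting from \<open>q u / 2\<close>, the derivative of the data on v = 0.\<close>
  define K where "K u v = (LBINT t=ereal 0..ereal v. k u t)" for u v
  define Hu where "Hu u v = q u / 2 + K u v" for u v
  have k_line: "continuous_on S (k u)" if "\<And>v. v \<in> S \<Longrightarrow> \<bar>u\<bar> + \<bar>v\<bar> \<le> b" for u S
    by (rule continuous_on_compose2[OF k_cont, of S "\<lambda>v. (u, v)", simplified])
      (use that in \<open>auto intro!: continuous_intros\<close>)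
  have Huv: "(Hu u has_vector_derivative k u v) (at v)" if uv: "\<bar>u\<bar> + \<bar>v\<bar> < b" for u v
  proof -
    let ?d = "b - \<bar>u\<bar>"
    have v: "v \<in> {-?d<..<?d}" using uv by auto
    have "continuous_on {-?d..?d} (k u)" by (rule k_line) auto
    then have "(K u has_vector_derivative k u v) (at v within {-?d..?d})"
      unfolding K_def using v by (intro interval_integral_FTC2) auto
    then have "(K u has_vector_derivative k u v) (at v)"
      using v by (simp add: at_within_Icc_at)
    then show ?thesis
      unfolding Hu_def[abs_def] by (auto intro!: derivative_eq_intros)
  qed
  have Hu_0: "Hu u 0 = q u / 2" for u
    by (simp add: Hu_def K_def)
  \<comment> \<open>Differentiation under the integral that represents
    \<open>H y v1 - H y v0\<close>. One endpoint will be 0, and the order of the endpoints covers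
    both signs of v.\<close>
  have diff: "((\<lambda>y. H y v1 - H y v0) has_vector_derivative integral {v0..v1} (k u)) (at u)"
    if "v0 \<le> v1" "\<bar>u\<bar> + \<bar>v0\<bar> < b" "\<bar>u\<bar> + \<bar>v1\<bar> < b" for u v0 v1
  proof -
    \<comment> \<open>The Leibniz rule needs a rectangle; this half-width keeps \<open>?U\<close>
      times \<open>{v0..v1}\<close> inside the open diamond.\<close>
    define m where "m = b - max \<bar>v0\<bar> \<bar>v1\<bar>"
    let ?U = "{-m<..<m}"
    have rect: "\<bar>y\<bar> + \<bar>t\<bar> < b" if "y \<in> ?U" "t \<in> {v0..v1}" for y t
    proof -
      have "\<bar>y\<bar> < m" using that(1) by auto
      moreover have "\<bar>t\<bar> \<le> max \<bar>v0\<bar> \<bar>v1\<bar>" using that(2) by auto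
      ultimately show ?thesis by (simp add: m_def)
    qed
    have u: "u \<in> ?U" using that unfolding m_def by (cases "\<bar>v0\<bar> \<le> \<bar>v1\<bar>") auto
    have FTC: "(Hv y has_integral H y v1 - H y v0) {v0..v1}" if "y \<in> ?U" for y
      by (rule fundamental_theorem_of_calculus[OF \<open>v0 \<le> v1\<close>])
        (rule has_vector_derivative_at_within[OF Hv[OF rect[OF that]]])
    have "((\<lambda>y. integral (cbox v0 v1) (Hv y)) has_vector_derivative integral (cbox v0 v1) (k u)) (at u within ?U)"
    proof (rule leibniz_rule_vector_derivative)
      show "((\<lambda>x. Hv x t) has_vector_derivative k x t) (at x within ?U)"
        if "x \<in> ?U" "t \<in> cbox v0 v1" for x t
        by (rule has_vector_derivative_at_within[OF Hvu[OF rect]]) (use that in auto)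
      show "Hv x integrable_on cbox v0 v1" if "x \<in> ?U" for x
        using FTC[OF that] by auto
      show "continuous_on (?U \<times> cbox v0 v1) (\<lambda>(x, t). k x t)"
      proof (rule continuous_on_subset[OF k_cont], clarify)
        fix y t assume "y \<in> ?U" "t \<in> cbox v0 v1"
        then have "\<bar>y\<bar> + \<bar>t\<bar> < b" by (intro rect) simp_all
        then show "\<bar>y\<bar> + \<bar>t\<bar> \<le> b" by simp
      qed
      show "convex ?U" by (rule convex_real_interval)
    qed (rule u)
    then have "((\<lambda>y. integral {v0..v1} (Hv y)) has_vector_derivative integral {v0..v1} (k u)) (at u)"
      by (simp only: at_within_open[OF u open_greaterThanLessThan] cbox_interval)
    then show ?thesis
      by (rule has_vector_derivative_transform_within_open[OF _ open_greaterThanLessThan u])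
        (rule integral_unique[OF FTC])
  qed
  have int: "(LBINT t=ereal c..ereal d. k u t) = integral {c..d} (k u)"
    if "c \<le> d" "\<And>t. t \<in> {c..d} \<Longrightarrow> \<bar>u\<bar> + \<bar>t\<bar> \<le> b" for u c d
    using that by (intro interval_integral_eq_integral borel_integrable_atLeastAtMost' k_line) auto
  have Hu: "((\<lambda>y. H y v) has_vector_derivative Hu u v) (at u)" if uv: "\<bar>u\<bar> + \<bar>v\<bar> < b" for u v
  proof -
    have u: "u \<in> {-b<..<b}" using uv by auto
    have "((\<lambda>y. LBINT s=ereal 0..ereal y. q s) has_vector_derivative q u) (at u within {-b..b})"
      by (intro interval_integral_FTC2 q) (use u in auto)
    then have "((\<lambda>y. LBINT s=ereal 0..ereal y. q s) has_vector_derivative q u) (at u)"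
      using u by (simp add: at_within_Icc_at)
    then have "((\<lambda>y. h / 2 + (1 / 2) * (LBINT s=ereal 0..ereal y. q s)) has_vector_derivative q u / 2) (at u)"
      by (auto intro!: derivative_eq_intros)
    then have 0: "((\<lambda>y. H y 0) has_vector_derivative q u / 2) (at u)"
      by (rule has_vector_derivative_transform_within_open[OF _ open_greaterThanLessThan u])
        (simp add: H_u0)
    show ?thesis
    proof (cases "v \<ge> 0")
      case True
      have "K u v = integral {0..v} (k u)"
        unfolding K_def using True uv by (subst int) auto
      moreover have "((\<lambda>y. H y 0 + (H y v - H y 0)) has_vector_derivative q u / 2 + integral {0..v} (k u)) (at u)"
        using True uv by (intro has_vector_derivative_add 0 diff) auto
      ultimately show ?thesis by (simp add: Hu_def)
    next
      case False
      have "K u v = - integral {v..0} (k u)"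
        unfolding K_def using False uv
        by (subst interval_integral_endpoints_reverse) (subst int, auto)
      moreover have "((\<lambda>y. H y 0 - (H y 0 - H y v)) has_vector_derivative q u / 2 - integral {v..0} (k u)) (at u)"
        using False uv by (intro has_vector_derivative_diff 0 diff) auto
      ultimately show ?thesis by (simp add: Hu_def)
    qed
  qed
  have Hv_0: "Hv 0 v = 0" if "\<bar>v\<bar> < b" for v
  proof -
    have v: "v \<in> {-b<..<b}" using that by auto
    have "((\<lambda>_. h / 2) has_vector_derivative Hv 0 v) (at v)"
      by (rule has_vector_derivative_transform_within_open[OF Hv open_greaterThanLessThan v])
        (use that H_0v in auto)
    then show ?thesis
      using has_vector_derivative_const vector_derivative_unique_at by blast
  qed
  have seg: "\<bar>s\<bar> \<le> \<bar>w\<bar>" if "s \<in> closed_segment 0 w" for s w :: real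
    using that by (auto simp: closed_segment_eq_real_ivl split: if_splits)
  have Hv_bd: "cmod (Hv u v) \<le> B * b" if uv: "\<bar>u\<bar> + \<bar>v\<bar> < b" for u v
  proof -
    have dia: "\<bar>s\<bar> + \<bar>v\<bar> < b" if "s \<in> closed_segment 0 u" for s
      using seg[OF that] uv by linarith
    have "continuous_on (closed_segment 0 u) (\<lambda>y. Hv y v)"
      by (rule continuous_on_vector_derivative) (rule has_vector_derivative_at_within[OF Hvu[OF dia]])
    then have "cmod (Hv u v - Hv 0 v) \<le> B * \<bar>u - 0\<bar>"
      by (rule norm_diff_le_closed_segment)
        (use dia in \<open>auto intro!: Hvu B simp: open_segment_def less_imp_le\<close>)
    also have "\<dots> \<le> B * b" using uv \<open>B \<ge> 0\<close> by (intro mult_left_mono) auto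
    finally show ?thesis using Hv_0 uv by simp
  qed
  have Hu_bd: "cmod (Hu u v) \<le> Bq + B * b" if uv: "\<bar>u\<bar> + \<bar>v\<bar> < b" for u v
  proof -
    have dia: "\<bar>u\<bar> + \<bar>s\<bar> < b" if "s \<in> closed_segment 0 v" for s
      using seg[OF that] uv by linarith
    have "continuous_on (closed_segment 0 v) (Hu u)"
      by (rule continuous_on_vector_derivative) (rule has_vector_derivative_at_within[OF Huv[OF dia]])
    then have "cmod (Hu u v - Hu u 0) \<le> B * \<bar>v - 0\<bar>"
      by (rule norm_diff_le_closed_segment)
        (use dia in \<open>auto intro!: Huv B simp: open_segment_def less_imp_le\<close>)
    also have "\<dots> \<le> B * b" using uv \<open>B \<ge> 0\<close> by (intro mult_left_mono) auto
    finally have "cmod (Hu u v) \<le> cmod (q u / 2) + B * b"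
      using norm_triangle_sub[of "Hu u v" "Hu u 0"] by (simp add: Hu_0)
    also have "cmod (q u / 2) \<le> Bq"
    proof -
      have "u \<in> {-b..b}" using uv by auto
      from Bq[OF this] show ?thesis using \<open>Bq \<ge> 0\<close> by (simp add: norm_divide)
    qed
    finally show ?thesis by simp
  qed
  let ?M = "max (max (B * b) (Bq + B * b)) BH"
  have M: "cmod (Hu u v) \<le> ?M" "cmod (Hv u v) \<le> ?M" "cmod (H u v) \<le> ?M" if "\<bar>u\<bar> + \<bar>v\<bar> < b" for u v
    using Hu_bd[OF that] Hv_bd[OF that] BH[of u v] that by linarith+
  show ?thesis
    by (rule that[OF Hu Hv Huv[unfolded k_def] Hvu[unfolded k_def] Hu_0 Hv_0 M])
qed

section \<open>Uniqueness for a homogeneous hyperbolic system\<close>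

lemma norm_le_exp_growth:
  fixes \<phi> :: "real \<Rightarrow> complex"
  assumes "\<phi> 0 = 0" and "c \<ge> 0"
    and der: "\<And>t. \<bar>t\<bar> \<le> \<bar>v\<bar> \<Longrightarrow> (\<phi> has_vector_derivative \<phi>' t) (at t)"
    and bd: "\<And>t. \<bar>t\<bar> \<le> \<bar>v\<bar> \<Longrightarrow> cmod (\<phi>' t) \<le> G * (c * exp (2 * G * (a + \<bar>t\<bar>)))"
  shows "cmod (\<phi> v) \<le> c / 2 * exp (2 * G * (a + \<bar>v\<bar>))"
proof -
  let ?e = "\<lambda>\<tau>. c / 2 * exp (2 * G * (a + \<tau> * \<bar>v\<bar>))"
  have dia: "\<bar>\<tau> * v\<bar> \<le> \<bar>v\<bar>" if "\<tau> \<in> {0..1}" for \<tau>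
    using that by (simp add: abs_mult mult_left_le_one_le)
  have d: "((\<lambda>\<tau>. \<phi> (\<tau> * v)) has_vector_derivative v *\<^sub>R \<phi>' (\<tau> * v)) (at \<tau>)" if "\<tau> \<in> {0..1}" for \<tau>
  proof -
    have "((\<lambda>\<tau>. \<tau> * v) has_vector_derivative v) (at \<tau>)"
      by (auto simp: has_real_derivative_iff_has_vector_derivative[symmetric] intro!: derivative_eq_intros)
    from vector_diff_chain_at[OF this der[OF dia[OF that]]] show ?thesis by (simp add: o_def)
  qed
  have "cmod (\<phi> (1 * v) - \<phi> (0 * v)) \<le> ?e 1 - ?e 0"
  proof (rule differentiable_bound_general[where f' = "\<lambda>\<tau>. v *\<^sub>R \<phi>' (\<tau> * v)"
        and \<phi>' = "\<lambda>\<tau>. \<bar>v\<bar> * (G * (c * exp (2 * G * (a + \<tau> * \<bar>v\<bar>))))"])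
    show "continuous_on {0..1} (\<lambda>\<tau>. \<phi> (\<tau> * v))"
      by (rule continuous_on_vector_derivative) (rule has_vector_derivative_at_within[OF d])
    show "(?e has_vector_derivative \<bar>v\<bar> * (G * (c * exp (2 * G * (a + \<tau> * \<bar>v\<bar>))))) (at \<tau>)" for \<tau>
      by (auto intro!: derivative_eq_intros simp: has_real_derivative_iff_has_vector_derivative[symmetric])
    show "cmod (v *\<^sub>R \<phi>' (\<tau> * v)) \<le> \<bar>v\<bar> * (G * (c * exp (2 * G * (a + \<tau> * \<bar>v\<bar>))))"
      if "0 < \<tau>" "\<tau> < 1" for \<tau>
      using mult_left_mono[OF bd[OF dia[of \<tau>]], of "\<bar>v\<bar>"] that by (simp add: abs_mult)
  qed (auto intro!: d continuous_intros)
  moreover have "?e 0 \<ge> 0" using \<open>c \<ge> 0\<close> by simp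
  ultimately show ?thesis using \<open>\<phi> 0 = 0\<close> by simp
qed

text \<open>Each pass through the integrated system halves the constant in front of the weight
  \<open>exp (2 * G * (\<bar>u\<bar> + \<bar>v\<bar>))\<close>.\<close>

lemma hyperbolic_system_unique:
  fixes p r :: "real \<Rightarrow> real \<Rightarrow> complex"
  assumes p: "\<And>u v. \<bar>u\<bar> + \<bar>v\<bar> < b \<Longrightarrow> (p u has_vector_derivative g (u + v) * r u v) (at v)"
    and r: "\<And>u v. \<bar>u\<bar> + \<bar>v\<bar> < b \<Longrightarrow> ((\<lambda>y. r y v) has_vector_derivative g (u + v) * p u v) (at u)"
    and p0: "\<And>u. \<bar>u\<bar> < b \<Longrightarrow> p u 0 = 0" and r0: "\<And>v. \<bar>v\<bar> < b \<Longrightarrow> r 0 v = 0"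
    and M: "\<And>u v. \<bar>u\<bar> + \<bar>v\<bar> < b \<Longrightarrow> cmod (p u v) \<le> M" "\<And>u v. \<bar>u\<bar> + \<bar>v\<bar> < b \<Longrightarrow> cmod (r u v) \<le> M"
    and G: "\<And>x. \<bar>x\<bar> < b \<Longrightarrow> cmod (g x) \<le> G" "G \<ge> 0"
    and uv: "\<bar>u\<bar> + \<bar>v\<bar> < b"
  shows "p u v = 0"
proof -
  have "M \<ge> 0" using M(1)[OF uv] norm_ge_zero order_trans by blast
  define c where "c n = M / 2 ^ n" for n :: nat
  have c: "c n \<ge> 0" "c (Suc n) = c n / 2" for n using \<open>M \<ge> 0\<close> by (auto simp: c_def)
  have *: "cmod (p u v) \<le> c n * exp (2 * G * (\<bar>u\<bar> + \<bar>v\<bar>)) \<and> cmod (r u v) \<le> c n * exp (2 * G * (\<bar>u\<bar> + \<bar>v\<bar>))"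
    if "\<bar>u\<bar> + \<bar>v\<bar> < b" for u v n
    using that
  proof (induction n arbitrary: u v)
    case 0
    have "M * 1 \<le> M * exp (2 * G * (\<bar>u\<bar> + \<bar>v\<bar>))"
      using \<open>M \<ge> 0\<close> G(2) by (intro mult_left_mono) auto
    then show ?case using M[OF 0] by (auto simp: c_def)
  next
    case (Suc n)
    have "cmod (p u v) \<le> c n / 2 * exp (2 * G * (\<bar>u\<bar> + \<bar>v\<bar>))"
    proof (rule norm_le_exp_growth)
      fix t assume "\<bar>t\<bar> \<le> \<bar>v\<bar>"
      with Suc.prems have t: "\<bar>u\<bar> + \<bar>t\<bar> < b" by simp
      then show "(p u has_vector_derivative g (u + t) * r u t) (at t)" by (rule p)
      show "cmod (g (u + t) * r u t) \<le> G * (c n * exp (2 * G * (\<bar>u\<bar> + \<bar>t\<bar>)))"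
        unfolding norm_mult using Suc.IH[OF t] t G by (intro mult_mono) auto
    qed (use Suc.prems p0 c in auto)
    moreover have "cmod (r u v) \<le> c n / 2 * exp (2 * G * (\<bar>v\<bar> + \<bar>u\<bar>))"
    proof (rule norm_le_exp_growth[where \<phi> = "\<lambda>y. r y v"])
      fix t assume "\<bar>t\<bar> \<le> \<bar>u\<bar>"
      with Suc.prems have t: "\<bar>t\<bar> + \<bar>v\<bar> < b" by simp
      then show "((\<lambda>y. r y v) has_vector_derivative g (t + v) * p t v) (at t)" by (rule r)
      show "cmod (g (t + v) * p t v) \<le> G * (c n * exp (2 * G * (\<bar>v\<bar> + \<bar>t\<bar>)))"
        unfolding norm_mult using Suc.IH[OF t] t G by (intro mult_mono) (auto simp: add.commute)
    qed (use Suc.prems r0 c in auto)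
    ultimately show ?case unfolding c(2) by (simp only: add.commute)
  qed
  have "(\<lambda>n. M * exp (2 * G * (\<bar>u\<bar> + \<bar>v\<bar>)) * (1 / 2) ^ n) \<longlonglongrightarrow> M * exp (2 * G * (\<bar>u\<bar> + \<bar>v\<bar>)) * 0"
    by (intro tendsto_intros LIMSEQ_power_zero) auto
  then have "cmod (p u v) \<le> M * exp (2 * G * (\<bar>u\<bar> + \<bar>v\<bar>)) * 0"
    by (rule LIMSEQ_le_const) (use *[OF uv] in \<open>auto simp: c_def power_divide field_simps\<close>)
  then show ?thesis by simp
qed

section \<open>Formal powers and the approximants along characteristics\<close>

locale darboux_setting =
  fixes b :: real and q f f' f'' :: "real \<Rightarrow> complex"
  assumes b_pos: "b > 0"
    and q_cont: "continuous_on {-b..b} q"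
    and f_deriv: "\<And>x. x \<in> {-b..b} \<Longrightarrow> (f has_vector_derivative f' x) (at x within {-b..b})"
    and f'_deriv: "\<And>x. x \<in> {-b..b} \<Longrightarrow> (f' has_vector_derivative f'' x) (at x within {-b..b})"
    and ode: "\<And>x. x \<in> {-b..b} \<Longrightarrow> f'' x - q x * f x = 0"
    and f_nonzero: "\<And>x. x \<in> {-b..b} \<Longrightarrow> f x \<noteq> 0"
    and f_0: "f 0 = 1"
begin

lemma f_cont: "continuous_on {-b..b} f"
  using f_deriv by (metis continuous_on_vector_derivative)

lemma f'_cont: "continuous_on {-b..b} f'"
  using f'_deriv by (metis continuous_on_vector_derivative)

lemma rec_integral_deriv:
  assumes F: "continuous_on {-b..b} F" and x: "x \<in> {-b..b}"
  shows "((\<lambda>x. of_nat k * (LBINT s=ereal 0..ereal x. F s * ((f s)\<^sup>2) powi ((-1) ^ n)))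
    has_vector_derivative of_nat k * (F x * ((f x)\<^sup>2) powi ((-1) ^ n))) (at x within {-b..b})"
proof -
  have "continuous_on {-b..b} (\<lambda>s. F s * ((f s)\<^sup>2) powi ((-1) ^ n))"
    using f_nonzero by (intro continuous_intros F f_cont) auto
  then show ?thesis
    using x b_pos
    by (intro has_vector_derivative_mult_right interval_integral_FTC2) auto
qed

lemma rec_X_cont: "continuous_on {-b..b} (rec_X f n)"
proof (induction n)
  case (Suc n)
  show ?case
    unfolding rec_X.simps by (rule continuous_on_vector_derivative, rule rec_integral_deriv[OF Suc])
qed simp

lemma rec_Xt_cont: "continuous_on {-b..b} (rec_Xt f n)"
proof (induction n)
  case (Suc n)
  show ?case
    unfolding rec_Xt.simps by (rule continuous_on_vector_derivative, rule rec_integral_deriv[OF Suc])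
qed simp

lemma rec_X_deriv:
  assumes "x \<in> {-b..b}"
  shows "(rec_X f n has_vector_derivative
     of_nat n * (rec_X f (n - 1) x * ((f x)\<^sup>2) powi ((-1) ^ n))) (at x within {-b..b})"
proof (cases n)
  case (Suc m)
  then show ?thesis
    using rec_integral_deriv[OF rec_X_cont assms, of n m n] by simp
qed simp

lemma rec_Xt_deriv:
  assumes "x \<in> {-b..b}"
  shows "(rec_Xt f n has_vector_derivative
     of_nat n * (rec_Xt f (n - 1) x * ((f x)\<^sup>2) powi (- ((-1) ^ n)))) (at x within {-b..b})"
proof (cases n)
  case (Suc m)
  then show ?thesis
    using rec_integral_deriv[OF rec_Xt_cont assms, of n m m] by simp
qed simp

text \<open>The parity switch in \<open>phi\<close> selects the recursive integral whose last
  integrand carries \<open>f\<close> to the power -2; one factor \<open>f\<close> in front turns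
  this into \<open>1 / f\<close>, which is the prefactor of \<open>psi\<close>. At n = 0 the factor
  \<open>of_nat n\<close> makes the truncated index harmless.\<close>

lemma phi_deriv:
  assumes x: "x \<in> {-b..b}"
  shows "(phi f n has_vector_derivative f' x / f x * phi f n x + of_nat n * psi f (n - 1) x)
     (at x within {-b..b})"
proof (cases "odd n")
  case True
  have "((\<lambda>x. f x * rec_X f n x) has_vector_derivative f' x / f x * phi f n x + of_nat n * psi f (n - 1) x)
     (at x within {-b..b})"
    using True f_nonzero[OF x]
    by (intro has_vector_derivative_eq_rhs[OF has_vector_derivative_mult[OF f_deriv[OF x] rec_X_deriv[OF x]]])
      (simp add: phi_def psi_def field_simps power2_eq_square)
  then show ?thesis using True by (simp add: phi_def[abs_def])
next
  case False
  have "((\<lambda>x. f x * rec_Xt f n x) has_vector_derivative f' x / f x * phi f n x + of_nat n * psi f (n - 1) x)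
     (at x within {-b..b})"
    using False f_nonzero[OF x]
    by (intro has_vector_derivative_eq_rhs[OF has_vector_derivative_mult[OF f_deriv[OF x] rec_Xt_deriv[OF x]]])
      (cases n; simp add: phi_def psi_def field_simps power2_eq_square)
  then show ?thesis using False by (simp add: phi_def[abs_def])
qed

text \<open>The product \<open>f * psi\<close> is a bare recursive integral, whose last integrand
  carries \<open>f\<close> to the power 2. Using it in place of \<open>psi\<close> absorbs the term
  with the logarithmic derivative.\<close>

lemma f_psi_deriv:
  assumes x: "x \<in> {-b..b}"
  shows "((\<lambda>x. f x * psi f n x) has_vector_derivative of_nat n * (f x * phi f (n - 1) x))
     (at x within {-b..b})"
proof (cases "odd n")
  case True
  have "(rec_Xt f n has_vector_derivative of_nat n * (f x * phi f (n - 1) x)) (at x within {-b..b})"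
    using rec_Xt_deriv[OF x, of n] True by (simp add: phi_def power2_eq_square mult_ac)
  then show ?thesis
    by (rule has_vector_derivative_transform[OF x, rotated]) (use True f_nonzero in \<open>simp add: psi_def\<close>)
next
  case False
  have "(rec_X f n has_vector_derivative of_nat n * (f x * phi f (n - 1) x)) (at x within {-b..b})"
    using rec_X_deriv[OF x, of n] False by (cases n) (simp_all add: phi_def power2_eq_square mult_ac)
  then show ?thesis
    by (rule has_vector_derivative_transform[OF x, rotated]) (use False f_nonzero in \<open>simp add: psi_def\<close>)
qed

text \<open>The lines t = \<open>\<tau> * (x - c)\<close> with \<open>\<tau>\<close> = 1 or -1 are
  the characteristics. The terms of degree n - 1 cancel because the square of \<open>\<tau>\<close>
  is 1; \<open>f'\<close> appears twice, once from the factor \<open>f\<close> and once from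
  \<open>phi_deriv\<close>.\<close>

lemma umbral_poly_line_deriv:
  assumes x: "x \<in> {-b..b}" and \<tau>: "\<tau> * \<tau> = 1"
  shows "((\<lambda>s. f s * (umbral_poly (phi f) n s (\<tau> * (s - c)) - of_real \<tau> * umbral_poly (psi f) n s (\<tau> * (s - c))))
    has_vector_derivative 2 * f' x * umbral_poly (phi f) n x (\<tau> * (x - c))) (at x within {-b..b})"
proof -
  let ?t = "\<tau> * (x - c)" and ?\<chi> = "\<lambda>k x. f x * psi f k x"
  have T: "((\<lambda>s. \<tau> * (s - c)) has_vector_derivative \<tau>) (at x within {-b..b})"
    by (auto intro!: derivative_eq_intros simp: has_real_derivative_iff_has_vector_derivative[symmetric])
  have chi: "umbral_poly ?\<chi> m s t = f s * umbral_poly (psi f) m s t" for m s t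
    by (simp add: umbral_poly_def sum_distrib_left mult_ac)
  have 1: "((\<lambda>s. umbral_poly (phi f) n s (\<tau> * (s - c))) has_vector_derivative
      f' x / f x * umbral_poly (phi f) n x ?t + of_nat n * umbral_poly (psi f) (n - 1) x ?t
      + \<tau> * (of_nat n * umbral_poly (phi f) (n - 1) x ?t)) (at x within {-b..b})"
  proof -
    have "(\<Sum>k\<le>n. of_nat (n choose k) * (f' x / f x * phi f (n - k) x
          + of_nat (n - k) * psi f (n - k - 1) x) * complex_of_real ?t ^ k)
        = f' x / f x * umbral_poly (phi f) n x ?t + of_nat n * umbral_poly (psi f) (n - 1) x ?t"
      unfolding umbral_poly_lower_x[symmetric] unfolding umbral_poly_def
      by (simp add: sum_distrib_left sum.distrib[symmetric] ring_distribs mult_ac)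
    then show ?thesis
      using umbral_poly_deriv[where p = "phi f" and n = n, OF phi_deriv[OF x] T] by simp
  qed
  have "(\<Sum>k\<le>n. of_nat (n choose k) * (of_nat (n - k) * (f x * phi f (n - k - 1) x)) * complex_of_real ?t ^ k)
      = f x * (of_nat n * umbral_poly (phi f) (n - 1) x ?t)"
    unfolding umbral_poly_lower_x[symmetric] by (simp add: sum_distrib_left mult_ac)
  then have 2: "((\<lambda>s. umbral_poly ?\<chi> n s (\<tau> * (s - c))) has_vector_derivative
      f x * (of_nat n * umbral_poly (phi f) (n - 1) x ?t)
      + \<tau> * (of_nat n * (f x * umbral_poly (psi f) (n - 1) x ?t))) (at x within {-b..b})"
    using umbral_poly_deriv[where p = ?\<chi> and n = n, OF f_psi_deriv[OF x] T] by (simp add: chi)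
  have \<tau>': "complex_of_real \<tau> * (complex_of_real \<tau> * y) = y" for y
    by (metis \<tau> mult.assoc mult_1 of_real_1 of_real_mult)
  have "((\<lambda>s. f s * umbral_poly (phi f) n s (\<tau> * (s - c)) - \<tau> * umbral_poly ?\<chi> n s (\<tau> * (s - c)))
    has_vector_derivative 2 * f' x * umbral_poly (phi f) n x ?t) (at x within {-b..b})"
    by (rule has_vector_derivative_eq_rhs[OF has_vector_derivative_diff[OF
          has_vector_derivative_mult[OF f_deriv[OF x] 1] has_vector_derivative_mult_right[OF 2]]])
      (use f_nonzero[OF x] in \<open>simp add: algebra_simps \<tau>'\<close>)
  then show ?thesis by (simp add: chi algebra_simps)
qed

text \<open>Both equations of the system at once: \<open>\<sigma>\<close> = 1 follows a line of
  constant v, \<open>\<sigma>\<close> = -1 one of constant u. The reflected terms run along the line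
  of opposite slope, and the minus sign before them in \<open>approx_K_darboux_umbral\<close> is
  exactly what that slope requires.\<close>

lemma approx_line_deriv:
  assumes x: "x \<in> {-b..b}" and \<sigma>: "\<sigma> = 1 \<or> \<sigma> = -1"
  shows "((\<lambda>s. f s * (approx_K_darboux f N \<alpha> \<beta> s (\<sigma> * (s - c)) + of_real \<sigma> * approx_K f N \<alpha> \<beta> s (\<sigma> * (s - c))))
    has_vector_derivative of_real \<sigma> * (2 * f' x * approx_K f N \<alpha> \<beta> x (\<sigma> * (x - c)))) (at x within {-b..b})"
proof -
  let ?A = "\<lambda>n. (\<alpha> n + \<beta> n) / 2" and ?B = "\<lambda>n. (\<alpha> n - \<beta> n) / 2"
  let ?L = "\<lambda>\<tau> n s. f s * (umbral_poly (phi f) n s (\<tau> * (s - c)) - of_real \<tau> * umbral_poly (psi f) n s (\<tau> * (s - c)))"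
  let ?D = "\<lambda>\<tau> n. 2 * f' x * umbral_poly (phi f) n x (\<tau> * (x - c))"
  have "\<sigma> * \<sigma> = 1" "- \<sigma> * - \<sigma> = 1" using \<sigma> by auto
  note d = this[THEN umbral_poly_line_deriv[OF x, where c = c]]
  have "((\<lambda>s. of_real \<sigma> * (\<Sum>n\<le>N. ?A n * ?L \<sigma> n s + ?B n * ?L (- \<sigma>) n s))
      has_vector_derivative of_real \<sigma> * (\<Sum>n\<le>N. ?A n * ?D \<sigma> n + ?B n * ?D (- \<sigma>) n)) (at x within {-b..b})"
    by (intro has_vector_derivative_mult_right has_vector_derivative_sum has_vector_derivative_add d)
  also have "(\<lambda>s. of_real \<sigma> * (\<Sum>n\<le>N. ?A n * ?L \<sigma> n s + ?B n * ?L (- \<sigma>) n s))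
      = (\<lambda>s. f s * (approx_K_darboux f N \<alpha> \<beta> s (\<sigma> * (s - c)) + of_real \<sigma> * approx_K f N \<alpha> \<beta> s (\<sigma> * (s - c))))"
    using \<sigma> unfolding approx_K_umbral approx_K_darboux_umbral
    by (auto simp: sum_distrib_left sum.distrib[symmetric] sum_negf[symmetric] sum_subtractf[symmetric] algebra_simps
        intro!: ext sum.cong)
  also have "(\<Sum>n\<le>N. ?A n * ?D \<sigma> n + ?B n * ?D (- \<sigma>) n) = 2 * f' x * approx_K f N \<alpha> \<beta> x (\<sigma> * (x - c))"
    unfolding approx_K_umbral by (simp add: sum_distrib_left algebra_simps)
  finally show ?thesis .
qed

section \<open>The first-order system for the kernels\<close>

lemma f_deriv_at: "\<bar>x\<bar> < b \<Longrightarrow> (f has_vector_derivative f' x) (at x)"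
  using f_deriv[of x] by (simp add: abs_less_iff at_within_Icc_at)

text \<open>The Riccati equation for the logarithmic derivative; it links the two potentials through
  \<open>g\<close>.\<close>

lemma log_deriv_deriv_at:
  assumes x: "\<bar>x\<bar> < b"
  shows "((\<lambda>x. f' x / f x) has_vector_derivative q x - (f' x / f x)\<^sup>2) (at x)"
proof -
  have x': "x \<in> {-b..b}" using x by auto
  have "(f' has_vector_derivative q x * f x) (at x)"
    using f'_deriv[OF x'] ode[OF x'] x by (simp add: abs_less_iff at_within_Icc_at)
  moreover have "((\<lambda>x. inverse (f x)) has_vector_derivative - (f' x * (inverse (f x) * inverse (f x)))) (at x)"
    using field_vector_diff_chain_at[OF f_deriv_at[OF x] DERIV_inverse[OF f_nonzero[OF x']]]
    by (simp add: o_def power2_eq_square)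
  ultimately have "((\<lambda>x. f' x * inverse (f x)) has_vector_derivative
      f' x * - (f' x * (inverse (f x) * inverse (f x))) + q x * f x * inverse (f x)) (at x)"
    by (rule has_vector_derivative_mult)
  then show ?thesis
    using f_nonzero[OF x'] by (simp add: divide_inverse power2_eq_square mult_ac mult.left_commute[of "f x" "q x"])
qed

lemma darboux_potential_cont: "continuous_on {-b..b} (darboux_potential q f f')"
  unfolding darboux_potential_def using f_nonzero
  by (intro continuous_intros q_cont f_cont f'_cont) auto

text \<open>In characteristic coordinates the kernels satisfy the Vekua-type system \<open>p = 0\<close>, \<open>r = 0\<close>;
  the two defects \<open>p\<close> and \<open>r\<close> themselves solve a homogeneous hyperbolic system.\<close>

lemma kernels_line_deriv:
  assumes solH: "goursat_solution b q (f' 0) H"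
    and solD: "goursat_solution b (darboux_potential q f f') (- f' 0) HD"
    and sv: "\<bar>s - v\<bar> + \<bar>v\<bar> < b"
  shows "((\<lambda>s. f s * (HD (s - v) v + H (s - v) v)) has_vector_derivative 2 * f' s * H (s - v) v) (at s)"
proof -
  let ?qD = "darboux_potential q f f'"
  define g where "g x = f' x / f x" for x
  obtain Wu Wv M1 where W:
    "\<And>u v. \<bar>u\<bar> + \<bar>v\<bar> < b \<Longrightarrow> ((\<lambda>y. H y v) has_vector_derivative Wu u v) (at u)"
    "\<And>u v. \<bar>u\<bar> + \<bar>v\<bar> < b \<Longrightarrow> (H u has_vector_derivative Wv u v) (at v)"
    "\<And>u v. \<bar>u\<bar> + \<bar>v\<bar> < b \<Longrightarrow> (Wu u has_vector_derivative q (u + v) * H u v) (at v)"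
    "\<And>u v. \<bar>u\<bar> + \<bar>v\<bar> < b \<Longrightarrow> ((\<lambda>y. Wv y v) has_vector_derivative q (u + v) * H u v) (at u)"
    "\<And>u. Wu u 0 = q u / 2"
    "\<And>v. \<bar>v\<bar> < b \<Longrightarrow> Wv 0 v = 0"
    "\<And>u v. \<bar>u\<bar> + \<bar>v\<bar> < b \<Longrightarrow> cmod (Wu u v) \<le> M1"
    "\<And>u v. \<bar>u\<bar> + \<bar>v\<bar> < b \<Longrightarrow> cmod (Wv u v) \<le> M1"
    "\<And>u v. \<bar>u\<bar> + \<bar>v\<bar> < b \<Longrightarrow> cmod (H u v) \<le> M1"
    by (rule goursat_solution_derivs[OF solH q_cont]) blast
  obtain Zu Zv M2 where Z:
    "\<And>u v. \<bar>u\<bar> + \<bar>v\<bar> < b \<Longrightarrow> ((\<lambda>y. HD y v) has_vector_derivative Zu u v) (at u)"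
    "\<And>u v. \<bar>u\<bar> + \<bar>v\<bar> < b \<Longrightarrow> (HD u has_vector_derivative Zv u v) (at v)"
    "\<And>u v. \<bar>u\<bar> + \<bar>v\<bar> < b \<Longrightarrow> (Zu u has_vector_derivative ?qD (u + v) * HD u v) (at v)"
    "\<And>u v. \<bar>u\<bar> + \<bar>v\<bar> < b \<Longrightarrow> ((\<lambda>y. Zv y v) has_vector_derivative ?qD (u + v) * HD u v) (at u)"
    "\<And>u. Zu u 0 = ?qD u / 2"
    "\<And>v. \<bar>v\<bar> < b \<Longrightarrow> Zv 0 v = 0"
    "\<And>u v. \<bar>u\<bar> + \<bar>v\<bar> < b \<Longrightarrow> cmod (Zu u v) \<le> M2"
    "\<And>u v. \<bar>u\<bar> + \<bar>v\<bar> < b \<Longrightarrow> cmod (Zv u v) \<le> M2"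
    "\<And>u v. \<bar>u\<bar> + \<bar>v\<bar> < b \<Longrightarrow> cmod (HD u v) \<le> M2"
    by (rule goursat_solution_derivs[OF solD darboux_potential_cont]) blast
  have qD: "?qD x = 2 * (g x)\<^sup>2 - q x" for x
    by (simp add: darboux_potential_def g_def)
  have g': "(g has_vector_derivative q x - (g x)\<^sup>2) (at x)" if "\<bar>x\<bar> < b" for x
    using log_deriv_deriv_at[OF that] by (simp add: g_def[abs_def])
  have gv: "((\<lambda>y. g (u + y)) has_vector_derivative q (u + v) - (g (u + v))\<^sup>2) (at v)"
    and gu: "((\<lambda>y. g (y + v)) has_vector_derivative q (u + v) - (g (u + v))\<^sup>2) (at u)"
    if "\<bar>u\<bar> + \<bar>v\<bar> < b" for u v
  proof -
    have 0: "\<bar>u + v\<bar> < b" using that by linarith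
    have "((\<lambda>y. u + y) has_vector_derivative 1) (at v)" "((\<lambda>y. y + v) has_vector_derivative 1) (at u)"
      by (auto intro!: derivative_eq_intros)
    from this[THEN vector_diff_chain_at, OF g'[OF 0]]
    show "((\<lambda>y. g (u + y)) has_vector_derivative q (u + v) - (g (u + v))\<^sup>2) (at v)"
      "((\<lambda>y. g (y + v)) has_vector_derivative q (u + v) - (g (u + v))\<^sup>2) (at u)"
      by (simp_all add: o_def)
  qed
  have "continuous_on {-b..b} g"
    unfolding g_def using f_nonzero by (intro continuous_intros f_cont f'_cont) auto
  then obtain G where "G \<ge> 0" and G: "\<And>x. x \<in> {-b..b} \<Longrightarrow> cmod (g x) \<le> G"
    using continuous_on_compact_norm_bound[OF compact_Icc] by metis
  \<comment> \<open>With \<open>g' = q - g^2\<close> and \<open>?qD = 2 g^2 - q\<close> the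
    potentials cancel on differentiating: the v-derivative of \<open>p\<close> is \<open>g r\<close>
    and the u-derivative of \<open>r\<close> is \<open>g p\<close>.\<close>
  define p where "p u v = (Zu u v + Wu u v) + g (u + v) * (HD u v - H u v)" for u v
  define r where "r u v = (Zv u v - Wv u v) + g (u + v) * (HD u v + H u v)" for u v
  have data: "HD 0 y = - f' 0 / 2" "H 0 y = f' 0 / 2" if "\<bar>y\<bar> < b" for y
    using solH solD that by (auto simp: goursat_solution_def abs_less_iff)
  have "p u v = 0" if uv: "\<bar>u\<bar> + \<bar>v\<bar> < b" for u v
  proof (rule hyperbolic_system_unique[where b = b and g = g and r = r and G = G and M = "(M2 + M1) + G * (M2 + M1)"])
    fix u v :: real assume uv: "\<bar>u\<bar> + \<bar>v\<bar> < b"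
    show "(p u has_vector_derivative g (u + v) * r u v) (at v)"
      unfolding p_def[abs_def]
      by (rule has_vector_derivative_eq_rhs[OF has_vector_derivative_add[OF
            has_vector_derivative_add[OF Z(3)[OF uv] W(3)[OF uv]]
            has_vector_derivative_mult[OF gv[OF uv] has_vector_derivative_diff[OF Z(2)[OF uv] W(2)[OF uv]]]]])
        (simp add: r_def qD algebra_simps power2_eq_square)
    show "((\<lambda>y. r y v) has_vector_derivative g (u + v) * p u v) (at u)"
      unfolding r_def[abs_def]
      by (rule has_vector_derivative_eq_rhs[OF has_vector_derivative_add[OF
            has_vector_derivative_diff[OF Z(4)[OF uv] W(4)[OF uv]]
            has_vector_derivative_mult[OF gu[OF uv] has_vector_derivative_add[OF Z(1)[OF uv] W(1)[OF uv]]]]])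
        (simp add: p_def qD algebra_simps power2_eq_square)
    have "u + v \<in> {-b..b}" using uv by auto
    then have gb: "cmod (g (u + v) * y) \<le> G * (M2 + M1)" if "cmod y \<le> M2 + M1" for y
      unfolding norm_mult using G that by (intro mult_mono) (auto intro: \<open>G \<ge> 0\<close>)
    show "cmod (p u v) \<le> (M2 + M1) + G * (M2 + M1)"
      unfolding p_def
      by (intro norm_triangle_mono gb order_trans[OF norm_triangle_ineq4] add_mono Z W uv)
    show "cmod (r u v) \<le> (M2 + M1) + G * (M2 + M1)"
      unfolding r_def
      by (intro norm_triangle_mono gb order_trans[OF norm_triangle_ineq4] add_mono Z W uv)
  next
    fix u assume u: "\<bar>u\<bar> < b"
    \<comment> \<open>On v = 0 the kernel difference has derivative \<open>(?qD - q) / 2\<close>,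
      which is \<open>- g'\<close>, and value \<open>- f' 0\<close>, which is \<open>- g 0\<close>,
      at the origin; hence it equals \<open>- g\<close>. Since \<open>(?qD + q) / 2\<close> is the
      square of \<open>g\<close>, \<open>p\<close> vanishes there.\<close>
    let ?e = "\<lambda>y. HD y 0 - H y 0 + g y"
    have d: "(?e has_vector_derivative 0) (at y)" if y: "\<bar>y\<bar> < b" for y
      by (rule has_vector_derivative_eq_rhs[OF has_vector_derivative_add[OF
            has_vector_derivative_diff[OF Z(1) W(1)] g'[OF y]]])
        (use y in \<open>auto simp: Z W qD field_simps\<close>)
    have seg: "\<bar>y\<bar> < b" if "y \<in> closed_segment 0 u" for y
      using that u by (auto simp: closed_segment_eq_real_ivl split: if_splits)
    have "continuous_on (closed_segment 0 u) ?e"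
      by (rule continuous_on_vector_derivative) (rule has_vector_derivative_at_within[OF d[OF seg]])
    then have "cmod (?e u - ?e 0) \<le> 0 * \<bar>u - 0\<bar>"
      by (rule norm_diff_le_closed_segment) (auto intro!: d seg simp: open_segment_def)
    moreover have "?e 0 = 0"
      using data[of 0] b_pos f_0 by (simp add: g_def)
    ultimately have "HD u 0 - H u 0 = - g u"
      by (simp add: eq_neg_iff_add_eq_0)
    then show "p u 0 = 0"
      unfolding p_def Z W qD add_0_right by (simp add: power2_eq_square add_divide_distrib diff_divide_distrib)
  next
    fix v assume "\<bar>v\<bar> < b"
    then show "r 0 v = 0"
      by (simp add: r_def Z W data)
  next
    fix x assume "\<bar>x\<bar> < b"
    then show "cmod (g x) \<le> G" by (intro G) auto
  qed (use uv \<open>G \<ge> 0\<close> in auto)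
  then have p0: "p (s - v) v = 0" using sv by blast
  have s: "\<bar>s\<bar> < b" using sv by linarith
  have "((\<lambda>s. s - v) has_vector_derivative 1) (at s)"
    by (auto intro!: derivative_eq_intros)
  note chain = vector_diff_chain_at[OF this, unfolded o_def]
  have "f s \<noteq> 0" using s by (intro f_nonzero) auto
  \<comment> \<open>Together with \<open>p0\<close>, this turns
    \<open>f' (Z + W) + f (Z + W)_u\<close> into \<open>f' (Z + W) - f' (Z - W)\<close>.\<close>
  then have "f' s = g s * f s" by (simp add: g_def)
  then show ?thesis
    using p0
    by (intro has_vector_derivative_eq_rhs[OF has_vector_derivative_mult[OF f_deriv_at[OF s]
            has_vector_derivative_add[OF chain[OF Z(1)[OF sv]] chain[OF W(1)[OF sv]]]]])
      (simp add: p_def, algebra)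
qed

section \<open>The error estimate\<close>

text \<open>Origin of the constant: inside the bracket, 1 bounds the value at the origin,
  \<open>2 * F\<close> pays for passing from Z - W to Z + W at the corner (0, v), and
  \<open>2 * F' * b\<close> covers both legs, of total length at most \<open>b\<close>. Then
  \<open>m\<close> comes from dividing by \<open>f\<close>, and the outer 1 from subtracting
  W.\<close>

lemma darboux_error_bound:
  assumes solH: "goursat_solution b q (f' 0) H"
    and solD: "goursat_solution b (darboux_potential q f f') (- f' 0) HD"
    and \<beta>: "\<beta> 0 = f' 0 / 2"
    and F: "\<And>x. x \<in> {-b..b} \<Longrightarrow> cmod (f x) \<le> F"
    and F': "\<And>x. x \<in> {-b..b} \<Longrightarrow> cmod (f' x) \<le> F'"
    and m: "\<And>x. x \<in> {-b..b} \<Longrightarrow> cmod (1 / f x) \<le> m"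
    and S: "\<And>x t. x \<in> {-b..b} \<Longrightarrow> t \<in> {-b..b} \<Longrightarrow> cmod (kernel_of H x t - approx_K f N \<alpha> \<beta> x t) \<le> S"
    and x: "x \<in> {-b..b}" and t: "t \<in> {-b..b}"
  shows "cmod (kernel_of HD x t - approx_K_darboux f N \<alpha> \<beta> x t) \<le> (1 + m * (1 + 2 * F + 2 * F' * b)) * S"
proof -
  define W where "W x t = kernel_of H x t - approx_K f N \<alpha> \<beta> x t" for x t
  define Z where "Z x t = kernel_of HD x t - approx_K_darboux f N \<alpha> \<beta> x t" for x t
  define u where "u = (x + t) / 2"
  define v where "v = (x - t) / 2"
  have uv: "\<bar>u\<bar> + \<bar>v\<bar> \<le> b" and xt: "x = u + v" "t = u - v"
    using x t by (auto simp: u_def v_def field_simps)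
  then have v: "v \<in> {-b..b}" by auto
  have 0: "0 \<in> {-b..b}" using b_pos by auto
  have S: "cmod (W x t) \<le> S" if "x \<in> {-b..b}" "t \<in> {-b..b}" for x t
    unfolding W_def using S that .
  have "S \<ge> 0" using S[OF 0 0] norm_ge_zero order_trans by blast
  have "F' \<ge> 0" using F'[OF 0] norm_ge_zero order_trans by blast
  have "m \<ge> 0" using m[OF 0] norm_ge_zero order_trans by blast
  have f'W: "cmod (2 * f' y * W y z) \<le> 2 * F' * S" if "y \<in> {-b..b}" "z \<in> {-b..b}" for y z
    using mult_mono[OF F'[OF that(1)] S[OF that] \<open>F' \<ge> 0\<close>] by (simp add: norm_mult)
  have data: "HD 0 y = - f' 0 / 2" "H 0 y = f' 0 / 2" if "y \<in> {-b..b}" for y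
    using solH solD that by (auto simp: goursat_solution_def)
  \<comment> \<open>Points of the line v = w, parametrized by x = y.\<close>
  have K: "kernel_of H' y (y - 2 * w) = H' (y - w) w" for H' y w
  proof -
    have "(y + (y - 2 * w)) / 2 = y - w" "(y - (y - 2 * w)) / 2 = w" by (simp_all add: field_simps)
    then show ?thesis unfolding kernel_of_def by (simp only:)
  qed

  \<comment> \<open>First leg, u = 0, where t = - x. The kernel difference is the constant
    \<open>- f' 0\<close> there, so the derivative formula follows from the data and holds up to the
    ends of the interval.\<close>
  define D1 where "D1 y = f y * (Z y (- y) - W y (- y))" for y
  have D1: "(D1 has_vector_derivative - (2 * f' y * W y (- y))) (at y within {-b..b})" if y: "y \<in> {-b..b}" for y
  proof -
    have k: "kernel_of HD z (- z) = - f' 0 / 2" "kernel_of H z (- z) = f' 0 / 2" if "z \<in> {-b..b}" for z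
      using data[OF that] by (simp_all add: kernel_of_def)
    have "((\<lambda>s. - f' 0 * f s - f s * (approx_K_darboux f N \<alpha> \<beta> s (- s) - approx_K f N \<alpha> \<beta> s (- s)))
        has_vector_derivative - f' 0 * f' y - - (2 * f' y * approx_K f N \<alpha> \<beta> y (- y))) (at y within {-b..b})"
      using approx_line_deriv[OF y, of "-1" N \<alpha> \<beta> 0]
      by (intro has_vector_derivative_diff has_vector_derivative_mult_right f_deriv[OF y]) simp
    then have "(D1 has_vector_derivative - f' 0 * f' y - - (2 * f' y * approx_K f N \<alpha> \<beta> y (- y))) (at y within {-b..b})"
      by (rule has_vector_derivative_transform[OF y, rotated])
        (simp add: D1_def Z_def W_def k field_simps)
    then show ?thesis
      by (simp add: W_def k[OF y] algebra_simps)
  qed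
  have "cmod (D1 v - D1 0) \<le> 2 * F' * S * \<bar>v - 0\<bar>"
  proof (rule norm_diff_le_closed_segment)
    have seg: "y \<in> {-b..b}" if "y \<in> closed_segment 0 v" for y
      using that v by (auto simp: closed_segment_eq_real_ivl split: if_splits)
    show "continuous_on (closed_segment 0 v) D1"
      by (rule continuous_on_subset[OF continuous_on_vector_derivative[OF D1]]) (auto dest: seg)
    fix y assume y: "y \<in> open_segment 0 v"
    then have "-b < y" "y < b" using v b_pos by (auto simp: open_segment_eq_real_ivl split: if_splits)
    then show "(D1 has_vector_derivative - (2 * f' y * W y (- y))) (at y)"
      using D1[of y] by (simp add: at_within_Icc_at)
    show "cmod (- (2 * f' y * W y (- y))) \<le> 2 * F' * S"
      using f'W[of y "- y"] \<open>-b < y\<close> \<open>y < b\<close> by simp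
  qed
  \<comment> \<open>At the origin every \<open>psi f k\<close> with k > 0 vanishes, so the Darboux
    approximant reduces to \<open>- \<beta> 0\<close>. The prescribed \<open>\<beta> 0\<close>
    matches the kernel value \<open>- f' 0 / 2\<close>.\<close>
  moreover have "D1 0 = - W 0 0"
  proof -
    have psi: "psi f k 0 = 0" if "k > 0" for k
      using that by (cases k) (auto simp: psi_def)
    have "umbral_poly (psi f) n 0 0 = (if n = 0 then 1 else 0)" for n
    proof -
      have "umbral_poly (psi f) n 0 0 = (\<Sum>k\<le>n. if k = 0 then psi f n 0 else 0)"
        unfolding umbral_poly_def by (rule sum.cong) auto
      then show ?thesis using f_0 by (auto simp: psi psi_def[of _ 0])
    qed
    then have "approx_K_darboux f N \<alpha> \<beta> 0 0 = - (\<Sum>n\<le>N. if n = 0 then \<beta> 0 else 0)"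
      unfolding approx_K_darboux_umbral by (intro arg_cong[where f = uminus] sum.cong) (auto simp: field_simps)
    then have "approx_K_darboux f N \<alpha> \<beta> 0 0 = - \<beta> 0" by simp
    then have "Z 0 0 = 0"
      using data[OF 0] \<beta> by (simp add: Z_def kernel_of_def)
    then show ?thesis by (simp add: D1_def f_0)
  qed
  ultimately have b1: "cmod (D1 v) \<le> S + 2 * F' * S * \<bar>v\<bar>"
    using norm_triangle_sub[of "D1 v" "D1 0"] S[OF 0 0] by simp

  \<comment> \<open>Second leg, v fixed, with u = y - v running from 0 to its final value.\<close>
  define D2 where "D2 y = f y * (Z y (y - 2 * v) + W y (y - 2 * v))" for y
  have D2_eq: "D2 y = f y * (HD (y - v) v + H (y - v) v)
      - f y * (approx_K_darboux f N \<alpha> \<beta> y (y - 2 * v) + approx_K f N \<alpha> \<beta> y (y - 2 * v))" for y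
    unfolding D2_def Z_def W_def K by (simp add: algebra_simps)
  have D2: "cmod (D2 x - D2 v) \<le> 2 * F' * S * \<bar>x - v\<bar>"
  proof (rule norm_diff_le_closed_segment)
    have seg: "\<bar>y - v\<bar> \<le> \<bar>u\<bar>" if "y \<in> closed_segment v x" for y
      using that xt by (auto simp: closed_segment_eq_real_ivl split: if_splits)
    have Ib: "y \<in> {-b..b}" if "y \<in> closed_segment v x" for y
      using that v x by (auto simp: closed_segment_eq_real_ivl split: if_splits)
    have app: "((\<lambda>s. f s * (approx_K_darboux f N \<alpha> \<beta> s (s - 2 * v) + approx_K f N \<alpha> \<beta> s (s - 2 * v)))
        has_vector_derivative 2 * f' y * approx_K f N \<alpha> \<beta> y (y - 2 * v)) (at y within {-b..b})"
      if "y \<in> {-b..b}" for y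
      using approx_line_deriv[OF that, of 1 N \<alpha> \<beta> "2 * v"] by simp
    have ker: "continuous_on (closed_segment v x) (\<lambda>y. H' (y - v) v)" if "goursat_solution b q' h' H'" for q' h' H'
    proof -
      from that have "continuous_on {(u, v). \<bar>u\<bar> + \<bar>v\<bar> \<le> b} (\<lambda>(u, v). H' u v)"
        by (simp add: goursat_solution_def)
      then have "continuous_on (closed_segment v x) (\<lambda>y. (\<lambda>(u, v). H' u v) (y - v, v))"
      proof (rule continuous_on_compose2)
        show "(\<lambda>y. (y - v, v)) ` closed_segment v x \<subseteq> {(u, v). \<bar>u\<bar> + \<bar>v\<bar> \<le> b}"
          using seg uv by fastforce
      qed (intro continuous_intros)
      then show ?thesis by simp
    qed
    show "continuous_on (closed_segment v x) D2"
      unfolding D2_eq[abs_def]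
      by (intro continuous_on_diff continuous_on_mult continuous_on_add ker[OF solH] ker[OF solD]
          continuous_on_subset[OF f_cont] continuous_on_subset[OF continuous_on_vector_derivative[OF app]])
        (auto dest: Ib)
    fix y assume y: "y \<in> open_segment v x"
    \<comment> \<open>Strictly between the endpoints \<open>\<bar>y - v\<bar>\<close> is smaller
      than \<open>\<bar>u\<bar>\<close>, so the point is in the open diamond even when the target
      lies on the boundary.\<close>
    then have lt: "\<bar>y - v\<bar> + \<bar>v\<bar> < b"
      using uv xt by (auto simp: open_segment_eq_real_ivl split: if_splits)
    then have yb: "-b < y" "y < b" by auto
    show "(D2 has_vector_derivative 2 * f' y * W y (y - 2 * v)) (at y)"
      unfolding D2_eq[abs_def]
      by (rule has_vector_derivative_eq_rhs[OF has_vector_derivative_diff[OF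
            kernels_line_deriv[OF solH solD lt] app[of y, unfolded at_within_Icc_at[OF yb]]]])
        (use yb in auto, simp add: W_def K[of H] right_diff_distrib)
    show "cmod (2 * f' y * W y (y - 2 * v)) \<le> 2 * F' * S"
      using lt by (intro f'W) auto
  qed
  \<comment> \<open>The legs meet at (0, v), but they track Z - W and Z + W respectively.\<close>
  have "D2 v = D1 v + 2 * (f v * W v (- v))"
    by (simp add: D1_def D2_def algebra_simps)
  moreover have "cmod (f v * W v (- v)) \<le> F * S"
    unfolding norm_mult using F[OF v] S[of v "- v"] v
    by (intro mult_mono) (auto intro: order_trans[OF norm_ge_zero])
  ultimately have "cmod (D2 v) \<le> S + 2 * F' * S * \<bar>v\<bar> + 2 * (F * S)"
    using b1 norm_triangle_ineq[of "D1 v" "2 * (f v * W v (- v))"] by (simp add: norm_mult)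
  then have "cmod (D2 x) \<le> S + 2 * (F * S) + 2 * F' * S * (\<bar>u\<bar> + \<bar>v\<bar>)"
    using D2 norm_triangle_sub[of "D2 x" "D2 v"] xt by (simp add: algebra_simps)
  also have "\<dots> \<le> S + 2 * (F * S) + 2 * F' * S * b"
    using uv \<open>F' \<ge> 0\<close> \<open>S \<ge> 0\<close> by (intro add_left_mono mult_left_mono) auto
  finally have D2x: "cmod (D2 x) \<le> (1 + 2 * F + 2 * F' * b) * S"
    by (simp add: algebra_simps)
  have "x - 2 * v = t" using xt by simp
  then have "D2 x = f x * (Z x t + W x t)" by (simp only: D2_def)
  then have "Z x t = 1 / f x * D2 x - W x t"
    using f_nonzero[OF x] by (simp add: field_simps)
  then have "cmod (Z x t) \<le> cmod (1 / f x) * cmod (D2 x) + cmod (W x t)"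
    using norm_triangle_ineq4[of "1 / f x * D2 x" "W x t"] by (simp add: norm_mult norm_divide)
  also have "\<dots> \<le> m * ((1 + 2 * F + 2 * F' * b) * S) + S"
    using m[OF x] D2x S[OF x t] \<open>m \<ge> 0\<close> by (intro add_mono mult_mono) auto
  finally show ?thesis by (simp add: Z_def algebra_simps)
qed

text \<open>A real supremum bounds its family only if the family is bounded above; this makes the
  hypothesis on \<open>SUP\<close> usable pointwise.\<close>

lemma approx_error_bdd:
  assumes "goursat_solution b q (f' 0) H"
  shows "bdd_above ((\<lambda>(x, t). cmod (kernel_of H x t - approx_K f N \<alpha> \<beta> x t)) ` ({-b..b} \<times> {-b..b}))"
proof -
  let ?Q = "{-b..b} \<times> {-b..b}"
  have phi: "continuous_on ?Q (\<lambda>z. phi f k (fst z))" for k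
    by (rule continuous_on_compose2[OF continuous_on_vector_derivative[OF phi_deriv]])
      (auto intro!: continuous_intros)
  have "continuous_on {(u, v). \<bar>u\<bar> + \<bar>v\<bar> \<le> b} (\<lambda>(u, v). H u v)"
    using assms by (simp add: goursat_solution_def)
  then have "continuous_on ?Q (\<lambda>z. (\<lambda>(u, v). H u v) ((fst z + snd z) / 2, (fst z - snd z) / 2))"
    by (rule continuous_on_compose2) (auto intro!: continuous_intros simp: field_simps)
  then have "continuous_on ?Q (\<lambda>z. kernel_of H (fst z) (snd z))"
    by (simp add: kernel_of_def)
  then have "continuous_on ?Q (\<lambda>z. cmod (kernel_of H (fst z) (snd z) - approx_K f N \<alpha> \<beta> (fst z) (snd z)))"
    unfolding approx_K_umbral umbral_poly_def by (intro continuous_intros phi)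
  then have "compact ((\<lambda>z. cmod (kernel_of H (fst z) (snd z) - approx_K f N \<alpha> \<beta> (fst z) (snd z))) ` ?Q)"
    by (rule compact_continuous_image) (intro compact_Times compact_Icc)
  then show ?thesis
    by (simp add: case_prod_beta bounded_imp_bdd_above compact_imp_bounded)
qed

end

theorem theorem6p4:
  fixes b :: real and q f f' f'' :: "real \<Rightarrow> complex"
  assumes "b > 0"
    and "continuous_on {-b..b} q"
    and "\<And>x. x \<in> {-b..b} \<Longrightarrow> (f has_vector_derivative f' x) (at x within {-b..b})"
    and "\<And>x. x \<in> {-b..b} \<Longrightarrow> (f' has_vector_derivative f'' x) (at x within {-b..b})"
    and "continuous_on {-b..b} f''"
    and "\<And>x. x \<in> {-b..b} \<Longrightarrow> f'' x - q x * f x = 0"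
    and "\<And>x. x \<in> {-b..b} \<Longrightarrow> f x \<noteq> 0"
    and "f 0 = 1"
  shows "\<exists>C :: real. \<forall>H HD (N :: nat) (\<alpha> :: nat \<Rightarrow> complex) (\<beta> :: nat \<Rightarrow> complex) (\<epsilon> :: real).
    goursat_solution b q (f' 0) H \<longrightarrow>
    goursat_solution b (darboux_potential q f f') (- f' 0) HD \<longrightarrow>
    \<beta> 0 = f' 0 / 2 \<longrightarrow>
    (SUP (x, t)\<in>{-b..b} \<times> {-b..b}. cmod (kernel_of H x t - approx_K f N \<alpha> \<beta> x t)) < \<epsilon> \<longrightarrow>
    (SUP (x, t)\<in>{-b..b} \<times> {-b..b}.
      cmod (kernel_of HD x t - approx_K_darboux f N \<alpha> \<beta> x t)) < \<epsilon> * C"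
proof -
  interpret darboux_setting b q f f' f''
    by unfold_locales (use assms in auto)
  obtain F where "F \<ge> 0" and F: "\<And>x. x \<in> {-b..b} \<Longrightarrow> cmod (f x) \<le> F"
    using continuous_on_compact_norm_bound[OF compact_Icc f_cont] by metis
  obtain F' where "F' \<ge> 0" and F': "\<And>x. x \<in> {-b..b} \<Longrightarrow> cmod (f' x) \<le> F'"
    using continuous_on_compact_norm_bound[OF compact_Icc f'_cont] by metis
  have "continuous_on {-b..b} (\<lambda>x. 1 / f x)"
    using f_nonzero by (intro continuous_intros f_cont) auto
  then obtain m where "m \<ge> 0" and m: "\<And>x. x \<in> {-b..b} \<Longrightarrow> cmod (1 / f x) \<le> m"
    using continuous_on_compact_norm_bound[OF compact_Icc] by metis
  \<comment> \<open>Fixed before the kernels, \<open>N\<close> and the coefficients, from bounds on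
    \<open>f\<close>, \<open>f'\<close> and \<open>1 / f\<close> alone. Its positivity keeps the
    final inequality strict.\<close>
  define C where "C = 1 + m * (1 + 2 * F + 2 * F' * b)"
  have "C > 0"
    unfolding C_def using \<open>F \<ge> 0\<close> \<open>F' \<ge> 0\<close> \<open>m \<ge> 0\<close> b_pos by (auto intro!: add_pos_nonneg mult_nonneg_nonneg)
  show ?thesis
  proof (intro exI allI impI)
    fix H HD N and \<alpha> \<beta> :: "nat \<Rightarrow> complex" and \<epsilon> :: real
    assume sol: "goursat_solution b q (f' 0) H" "goursat_solution b (darboux_potential q f f') (- f' 0) HD"
      and \<beta>: "\<beta> 0 = f' 0 / 2"
    let ?W = "\<lambda>(x, t). cmod (kernel_of H x t - approx_K f N \<alpha> \<beta> x t)"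
    let ?Z = "\<lambda>(x, t). cmod (kernel_of HD x t - approx_K_darboux f N \<alpha> \<beta> x t)"
    let ?Q = "{-b..b} \<times> {-b..b}"
    assume lt: "(SUP z\<in>?Q. ?W z) < \<epsilon>"
    have W: "?W z \<le> (SUP z\<in>?Q. ?W z)" if "z \<in> ?Q" for z
      by (rule cSUP_upper[OF that approx_error_bdd[OF sol(1)]])
    have "(SUP z\<in>?Q. ?Z z) \<le> C * (SUP z\<in>?Q. ?W z)"
    proof (rule cSUP_least)
      show "?Q \<noteq> {}" using b_pos by auto
      fix z assume "z \<in> ?Q"
      then obtain x t where z: "z = (x, t)" "x \<in> {-b..b}" "t \<in> {-b..b}" by auto
      show "?Z z \<le> C * (SUP z\<in>?Q. ?W z)"
        unfolding z(1) prod.case C_def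
        by (rule darboux_error_bound[where H = H and \<beta> = \<beta>, OF sol \<beta> F F' m]) (use W z in auto)
    qed
    also have "\<dots> < C * \<epsilon>" using lt \<open>C > 0\<close> by simp
    finally show "(SUP z\<in>?Q. ?Z z) < \<epsilon> * C" by (simp add: mult.commute)
  qed
qed

end
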